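(* There is a pp-construction of $K_3$ in $\mathbb C_3$.
   Context: $\mathbb C_3$ is the graph whose vertex set is a countable dense subset of the unit circle $S^1$ such that any two distinct points of it lie at a rational angle (in radians, hence never exactly $2\pi/3$), and $xy$ is an edge iff both circular arcs with end-points $x,y$ have length strictly larger than $1/3$ of the circumference (any such choice gives the same graph up to isomorphism). Let $G$ be a (not necessarily finite) graph. A graph $H$ has a primitive positive (pp) construction in $G$ if there exist $d\in\mathbb N$, a finite graph $K$, and $2d$ distinguished vertices $a_1,\dots,a_d,b_1,\dots,b_d\in V(K)$ (not necessarily distinct) such that $H$ is homomorphically equivalent to the graph with vertex set $V(G)^d$ where $u=(u_1,\dots,u_d)$ and $v=(v_1,\dots,v_d)$ are adjacent if and only if there exists a homomorphism from $K$ to $G$ that maps $(a_1,\dots,a_d)$ to $u$ and $(b_1,\dots,b_d)$ to $v$. (Two graphs are homomorphically equivalent if there are homomorphisms between them in both directions.) *)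

theory Defs
  imports "HOL-Analysis.Analysis" "Graph_Theory.Graph_Theory"
begin

text \<open>
  Graphs are symmetric digraphs with a set of pairs as arcs. The locale
  \<open>pair_bidirected_digraph\<close> describes simple, possibly infinite graphs, and \<open>pair_graph\<close> finite
  simple graphs.
\<close>

definition graph_hom :: "('a \<Rightarrow> 'b) \<Rightarrow> 'a pair_pre_digraph \<Rightarrow> 'b pair_pre_digraph \<Rightarrow> bool" where
  "graph_hom f G H \<longleftrightarrow>
     f ` pverts G \<subseteq> pverts H \<and> (\<forall>u v. (u, v) \<in> parcs G \<longrightarrow> (f u, f v) \<in> parcs H)"

definition hom_equivalent :: "'a pair_pre_digraph \<Rightarrow> 'b pair_pre_digraph \<Rightarrow> bool" where
  "hom_equivalent G H \<longleftrightarrow> (\<exists>f. graph_hom f G H) \<and> (\<exists>g. graph_hom g H G)"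

text \<open>
  The \<open>d\<close>-tuples over the vertex set of \<open>G\<close> are lists of length \<open>d\<close>; the lists \<open>a\<close> and \<open>b\<close>, also
  of length \<open>d\<close>, hold the distinguished vertices of \<open>K\<close>.
\<close>

definition pp_power ::
  "nat \<Rightarrow> 'k pair_pre_digraph \<Rightarrow> 'k list \<Rightarrow> 'k list \<Rightarrow> 'a pair_pre_digraph \<Rightarrow> 'a list pair_pre_digraph"
where
  "pp_power d K a b G =
     \<lparr> pverts = {u. length u = d \<and> set u \<subseteq> pverts G},
       parcs = {(map f a, map f b) | f. graph_hom f K G} \<rparr>"

text \<open>
  Up to isomorphism, every finite graph has vertices of type \<open>nat\<close>. The symmetry condition says
  that the constructed adjacency relation is that of an undirected graph, which is not automatic.
\<close>

definition has_pp_construction :: "'h pair_pre_digraph \<Rightarrow> 'a pair_pre_digraph \<Rightarrow> bool" where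
  "has_pp_construction H G \<longleftrightarrow>
     (\<exists>d (K :: nat pair_pre_digraph) a b.
        pair_graph K \<and>
        length a = d \<and> set a \<subseteq> pverts K \<and>
        length b = d \<and> set b \<subseteq> pverts K \<and>
        symmetric (with_proj (pp_power d K a b G)) \<and>
        hom_equivalent H (pp_power d K a b G))"

text \<open>
  Angles are taken modulo \<open>2 * pi\<close>: two points lie at a rational angle if some rotation by a rational
  number of radians takes one to the other. Requiring the representative in \<open>{0..pi}\<close> to be
  rational would rule out all dense sets.
\<close>

definition C3_vertex_set :: "complex set \<Rightarrow> bool" where
  "C3_vertex_set V \<longleftrightarrow>
     V \<subseteq> sphere 0 1 \<and> countable V \<and> sphere 0 1 \<subseteq> closure V \<and>
     (\<forall>x\<in>V. \<forall>y\<in>V. x \<noteq> y \<longrightarrow> (\<exists>q\<in>\<rat>. y = x * cis q))"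

text \<open>
  For \<open>x\<close> and \<open>y\<close> on the unit circle, the length of the arc that runs counterclockwise from \<open>x\<close>
  to \<open>y\<close>. The two arcs with end-points \<open>x\<close>, \<open>y\<close> are the one from \<open>x\<close> to \<open>y\<close> and the one from \<open>y\<close>
  to \<open>x\<close>.
\<close>

definition ccw_arc_length :: "complex \<Rightarrow> complex \<Rightarrow> real" where
  "ccw_arc_length x y = Arg2pi (y / x)"

definition C3 :: "complex set \<Rightarrow> complex pair_pre_digraph" where
  "C3 V =
     \<lparr> pverts = V,
       parcs = {(x, y). x \<in> V \<and> y \<in> V \<and>
                  ccw_arc_length x y > (2 * pi) / 3 \<and> ccw_arc_length y x > (2 * pi) / 3} \<rparr>"

lemma pair_bidirected_digraph_C3: "pair_bidirected_digraph (C3 V)"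
proof -
  have "Arg2pi (x / x) \<le> 2 * pi / 3" for x :: complex
    by (cases "x = 0") (auto simp: Arg2pi_of_real[of 1, simplified] Arg2pi_of_real[of 0, simplified])
  then show ?thesis
    by unfold_locales
      (auto simp: C3_def ccw_arc_length_def symmetric_def arcs_ends_def arc_to_ends_def
         with_proj_def not_less[symmetric] intro!: symI)
qed

lemma C3_vertex_set_exists: "C3_vertex_set (cis ` \<rat>)"
  unfolding C3_vertex_set_def
proof (intro conjI ballI impI)
  show "cis ` \<rat> \<subseteq> sphere 0 1"
    by auto
  show "countable (cis ` \<rat>)"
    by (intro countable_image countable_rat)
  have "cis ` closure \<rat> \<subseteq> closure (cis ` \<rat>)"
    by (rule image_closure_subset) (auto intro!: continuous_intros closure_subset)
  moreover have "sphere 0 1 \<subseteq> range cis"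
  proof
    fix z :: complex
    assume "z \<in> sphere 0 1"
    then have "z = cis (Arg2pi z)"
      using Arg2pi_eq[of z] by (simp add: cis_conv_exp)
    then show "z \<in> range cis"
      by blast
  qed
  ultimately show "sphere 0 1 \<subseteq> closure (cis ` \<rat>)"
    by (auto simp: Rats_closure_real)
  fix x y
  assume "x \<in> cis ` \<rat>" "y \<in> cis ` \<rat>"
  then obtain p q where "p \<in> \<rat>" "q \<in> \<rat>" "x = cis p" "y = cis q"
    by auto
  then show "\<exists>q\<in>\<rat>. y = x * cis q"
    by (intro bexI[of _ "q - p"]) (auto simp: cis_mult)
qed

end

theory Submission
  imports Defs
begin

text \<open>
  Lengths in this explanation are fractions of the circumference, so two points of the circle are
  adjacent iff their distance along the circle exceeds \<open>1/3\<close>. Fix a vertex \<open>c\<close>, take it as the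
  origin, and cut the circle into the sectors \<open>0 = [0, 1/3)\<close>, \<open>1 = [1/3, 2/3]\<close> and
  \<open>2 = (2/3, 1)\<close>. Two points of the same sector are never adjacent, so the sector relative to \<open>c\<close>
  is a proper 3-colouring of the circle. The graph itself has no triangle, though: the
  task is to find, by a pp-formula with \<open>c\<close> as a parameter, a symmetric relation that still
  separates the sectors but does hold on some triangle.
  Parameters cost nothing: they are further coordinates of the tuples, and an edge demands that
  both its ends carry the same ones.

  If there is a walk of length two between two points, their distance is less than \<open>1/3\<close>.
  Hence the points that such a walk joins to \<open>c\<close> lie in the sectors 0 and 2. Consider a
  path \<open>x, p, q, y\<close>.

  \<^item> If \<open>p\<close> and \<open>q\<close> avoid sector 1, then \<open>x\<close> and \<open>y\<close> are not both in sector 0, as this would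
    put both \<open>p\<close> and \<open>q\<close> into sector 2; likewise, \<open>x\<close> and \<open>y\<close> are not both in sector 2.
  \<^item> If \<open>p\<close> and \<open>q\<close> avoid sector 2, or both avoid sector 0, then in the same way \<open>x\<close> and \<open>y\<close>
    are not both in sector 1.

  The first condition on \<open>p\<close> and \<open>q\<close> is the walk of length two to \<open>c\<close>. For the second, a
  further parameter \<open>e\<close> is used, which also lies in sector 0 or 2. A neighbour \<open>d\<close> of \<open>e\<close> that
  avoids sector 1 is in the opposite one of these two sectors. Such a \<open>d\<close>, called a guard below,
  keeps its neighbours out of its own sector. The guards of \<open>p\<close> and of \<open>q\<close> must be different
  points, as all neighbours of one point lie on an arc of length \<open>1/3\<close>, but both lie in the same
  sector since \<open>e\<close> is fixed. Requiring one path of each kind between \<open>x\<close> and \<open>y\<close> gives the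
  relation \<open>linked\<close>, which is described by a finite graph (\<open>arcs_gadget_power\<close>) and only holds
  between different sectors (\<open>linked_sector_neq\<close>).

  Linked triangles do exist (\<open>linked_triangle_exists\<close>). One is found on the points \<open>k/11\<close> of the
  circle. All adjacencies used there are strict inequalities, so they survive when these points
  are moved slightly into the given dense set (\<open>circular_clique_in_C3\<close>).
\<close>

section \<open>Adjacency on the circle\<close>

lemma cos_less_minus_half_iff:
  fixes t :: real
  assumes "\<bar>t\<bar> < 2 * pi"
  shows "cos t < - 1 / 2 \<longleftrightarrow> 2 * pi / 3 < \<bar>t\<bar> \<and> \<bar>t\<bar> < 4 * pi / 3"
proof -
  have below_pi: "cos s < - 1 / 2 \<longleftrightarrow> 2 * pi / 3 < s" if "0 \<le> s" "s \<le> pi" for s :: real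
    using cos_mono_less_eq[of s "2 * pi / 3"] that cos_120 by simp
  show ?thesis
  proof (cases "\<bar>t\<bar> \<le> pi")
    case True
    then show ?thesis
      using below_pi[of "\<bar>t\<bar>"] pi_gt_zero by auto
  next
    case False
    have "cos t = cos (2 * pi - \<bar>t\<bar>)"
      by simp
    then show ?thesis
      using below_pi[of "2 * pi - \<bar>t\<bar>"] False assms by (auto simp: field_simps)
  qed
qed

text \<open>
  The inner product makes adjacency visibly an open condition on pairs of points and invariant
  under rotation.
\<close>

lemma C3_arc_iff_inner:
  assumes "V \<subseteq> sphere 0 1"
  shows "(x, y) \<in> parcs (C3 V) \<longleftrightarrow> x \<in> V \<and> y \<in> V \<and> x \<bullet> y < - 1 / 2"
proof (cases "x \<in> V \<and> y \<in> V")
  case True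
  then have norms: "norm x = 1" "norm y = 1"
    using assms by auto
  define t where "t = Arg2pi (y / x)"
  have bounds: "0 \<le> t" "t < 2 * pi"
    by (simp_all add: t_def Arg2pi_ge_0 Arg2pi_lt_2pi)
  have "y / x = cis t"
    using Arg2pi_eq[of "y / x"] norms by (simp add: t_def norm_divide cis_conv_exp)
  then have "Re (y / x) = cos t"
    by simp
  moreover have "Re (y / x) = x \<bullet> y"
    using norms by (simp add: Re_divide inner_complex_def cmod_def algebra_simps)
  ultimately have inner: "x \<bullet> y = cos t"
    by simp
  have "Arg2pi (x / y) = (if t = 0 then 0 else 2 * pi - t)"
  proof -
    have "x / y = cis (- t)"
      using \<open>y / x = cis t\<close> by (metis cis_inverse inverse_divide)
    then have "x / y = cis (if t = 0 then 0 else 2 * pi - t)"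
      by (simp add: cis.ctr)
    then show ?thesis
      using bounds by (intro Arg2pi_unique[of 1]) (auto simp: cis_conv_exp)
  qed
  then show ?thesis
    using True bounds pi_gt_zero cos_less_minus_half_iff[of t]
    by (auto simp: C3_def ccw_arc_length_def inner simp flip: t_def)
next
  case False
  then show ?thesis
    by (auto simp: C3_def)
qed

text \<open>
  With angles measured from one fixed vertex \<open>c\<close>, adjacency becomes linear arithmetic.
\<close>

lemma C3_arc_iff_angle:
  assumes "V \<subseteq> sphere 0 1" "c \<in> V" "x \<in> V" "y \<in> V"
  shows "(x, y) \<in> parcs (C3 V) \<longleftrightarrow>
    2 * pi / 3 < \<bar>Arg2pi (x / c) - Arg2pi (y / c)\<bar> \<and>
    \<bar>Arg2pi (x / c) - Arg2pi (y / c)\<bar> < 4 * pi / 3"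
proof -
  have polar: "z = c * cis (Arg2pi (z / c))" if "z \<in> V" for z
    using Arg2pi_eq[of "z / c"] assms(1,2) that
    by (force simp: subset_iff norm_divide cis_conv_exp)
  have "(c * a) \<bullet> (c * b) = a \<bullet> b" for a b :: complex
  proof -
    have "Re c ^ 2 + Im c ^ 2 = 1"
      using assms(1,2) by (auto simp: subset_iff cmod_def)
    moreover have "(c * a) \<bullet> (c * b) = (Re c ^ 2 + Im c ^ 2) * (a \<bullet> b)"
      by (simp add: inner_complex_def power2_eq_square algebra_simps)
    ultimately show ?thesis
      by simp
  qed
  then have "x \<bullet> y = cis (Arg2pi (x / c)) \<bullet> cis (Arg2pi (y / c))"
    using polar[of x] polar[of y] assms by metis
  also have "\<dots> = cos (Arg2pi (x / c) - Arg2pi (y / c))"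
    by (simp add: inner_complex_def cos_diff)
  finally have "x \<bullet> y = cos (Arg2pi (x / c) - Arg2pi (y / c))" .
  moreover have "\<bar>Arg2pi (x / c) - Arg2pi (y / c)\<bar> < 2 * pi"
    using Arg2pi_ge_0[of "x / c"] Arg2pi_ge_0[of "y / c"]
      Arg2pi_lt_2pi[of "x / c"] Arg2pi_lt_2pi[of "y / c"] by linarith
  moreover have "(x, y) \<in> parcs (C3 V) \<longleftrightarrow> x \<bullet> y < - 1 / 2"
    using assms by (simp add: C3_arc_iff_inner)
  ultimately show ?thesis
    by (simp only: cos_less_minus_half_iff)
qed

lemma sym_C3: "sym (parcs (C3 V))"
  by (auto simp: C3_def intro: symI)

lemma C3_arc_verts: "(x, y) \<in> parcs (C3 V) \<Longrightarrow> x \<in> V \<and> y \<in> V"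
  by (auto simp: C3_def)

text \<open>
  The points at angle \<open>2 * pi * k / n\<close>, which span a circular clique in the graph on the full
  circle, are limits of points of \<open>V\<close>, and finitely many strict inequalities between inner products hold
  simultaneously from some index of the approximating sequences on.
\<close>

lemma circular_clique_in_C3:
  fixes n :: nat
  assumes "V \<subseteq> sphere 0 1" "sphere 0 1 \<subseteq> closure V"
  shows "\<exists>P. \<forall>j<n. \<forall>k<n. n < 3 * \<bar>int j - int k\<bar> \<and> 3 * \<bar>int j - int k\<bar> < 2 * n
    \<longrightarrow> (P j, P k) \<in> parcs (C3 V)"
proof -
  define z where "z k = cis (2 * pi * real k / real n)" for k
  have "z k \<in> closure V" for k
    using assms(2) by (auto simp: z_def)
  then have "\<forall>k. \<exists>X. (\<forall>m. X m \<in> V) \<and> X \<longlonglongrightarrow> z k"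
    by (simp add: closure_sequential)
  then obtain X where X: "\<And>k m. X k m \<in> V" "\<And>k. X k \<longlonglongrightarrow> z k"
    by metis
  have ev: "\<forall>\<^sub>F m in sequentially. n < 3 * \<bar>int j - int k\<bar> \<and> 3 * \<bar>int j - int k\<bar> < 2 * n
      \<longrightarrow> (X j m, X k m) \<in> parcs (C3 V)"
    if jk: "j < n" "k < n" for j k
  proof (cases "n < 3 * \<bar>int j - int k\<bar> \<and> 3 * \<bar>int j - int k\<bar> < 2 * n")
    case True
    define t where "t = 2 * pi * real j / real n - 2 * pi * real k / real n"
    define u where "u = real_of_int \<bar>int j - int k\<bar>"
    have "real_of_int (int n) < real_of_int (3 * \<bar>int j - int k\<bar>)"
      "real_of_int (3 * \<bar>int j - int k\<bar>) < real_of_int (int (2 * n))"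
      using True by (simp_all only: of_int_less_iff)
    then have u: "real n < 3 * u" "3 * u < 2 * real n"
      by (simp_all add: u_def)
    have "0 < real n"
      using jk by simp
    have "t = 2 * pi / real n * (real j - real k)"
      by (simp add: t_def diff_divide_distrib algebra_simps)
    then have t: "\<bar>t\<bar> = 2 * pi / real n * u"
      by (simp add: u_def abs_mult)
    have "2 * pi / 3 < \<bar>t\<bar>" "\<bar>t\<bar> < 4 * pi / 3"
      using u \<open>0 < real n\<close> unfolding t by (simp_all add: field_simps)
    moreover have "\<bar>t\<bar> < 2 * pi"
      using \<open>\<bar>t\<bar> < 4 * pi / 3\<close> pi_gt_zero by linarith
    ultimately have "cos t < - 1 / 2"
      using cos_less_minus_half_iff by blast
    moreover have "z j \<bullet> z k = cos t"
      by (simp add: z_def t_def inner_complex_def cos_diff)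
    moreover have "(\<lambda>m. X j m \<bullet> X k m) \<longlonglongrightarrow> z j \<bullet> z k"
      by (intro tendsto_inner X)
    ultimately have "\<forall>\<^sub>F m in sequentially. X j m \<bullet> X k m < - 1 / 2"
      by (metis order_tendstoD(2))
    then show ?thesis
      by eventually_elim (use X(1) assms(1) in \<open>simp add: C3_arc_iff_inner\<close>)
  qed (intro always_eventually, blast)
  have "\<forall>\<^sub>F m in sequentially. \<forall>j\<in>{..<n}. \<forall>k\<in>{..<n}.
      n < 3 * \<bar>int j - int k\<bar> \<and> 3 * \<bar>int j - int k\<bar> < 2 * n
      \<longrightarrow> (X j m, X k m) \<in> parcs (C3 V)"
    by (intro eventually_ball_finite ballI ev) auto
  then obtain m where "\<forall>j\<in>{..<n}. \<forall>k\<in>{..<n}.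
      n < 3 * \<bar>int j - int k\<bar> \<and> 3 * \<bar>int j - int k\<bar> < 2 * n
      \<longrightarrow> (X j m, X k m) \<in> parcs (C3 V)"
    using eventually_happens'[OF sequentially_bot] by fast
  then show ?thesis
    by (intro exI[of _ "\<lambda>k. X k m"]) auto
qed

section \<open>The gadget\<close>

text \<open>
  Definability by a walk of length two; in the graph on the circle such a walk bounds the distance
  from \<open>c\<close> by a third of the circumference.
\<close>

definition near :: "'a pair_pre_digraph \<Rightarrow> 'a \<Rightarrow> 'a \<Rightarrow> bool" where
  "near G c p \<longleftrightarrow> (\<exists>r. (p, r) \<in> parcs G \<and> (r, c) \<in> parcs G)"

text \<open>
  The guard \<open>d\<close> stays on the side of \<open>c\<close> opposite to \<open>e\<close>, and thereby keeps \<open>p\<close> away from that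
  side.
\<close>

definition has_guard :: "'a pair_pre_digraph \<Rightarrow> 'a \<Rightarrow> 'a \<Rightarrow> 'a \<Rightarrow> bool" where
  "has_guard G c e p \<longleftrightarrow> (\<exists>d. (p, d) \<in> parcs G \<and> (d, e) \<in> parcs G \<and> near G c d)"

definition path_through :: "'a pair_pre_digraph \<Rightarrow> ('a \<Rightarrow> bool) \<Rightarrow> 'a \<Rightarrow> 'a \<Rightarrow> bool" where
  "path_through G S x y \<longleftrightarrow>
     (\<exists>p q. (x, p) \<in> parcs G \<and> (p, q) \<in> parcs G \<and> (q, y) \<in> parcs G \<and> S p \<and> S q)"

definition linked :: "'a pair_pre_digraph \<Rightarrow> 'a \<Rightarrow> 'a \<Rightarrow> 'a \<Rightarrow> 'a \<Rightarrow> bool" where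
  "linked G c e x y \<longleftrightarrow>
     near G c e \<and> path_through G (near G c) x y \<and> path_through G (has_guard G c e) x y"

text \<open>
  The edges spell out \<open>linked\<close>, with \<open>0, 1, 2, 3\<close> for \<open>x, y, c, e\<close>. The first line is \<open>near\<close> for
  \<open>e\<close>, with middle vertex 4. The second is the path through 5 and 6, with their walks to \<open>c\<close>. The
  last three are the path through 9 and 10, whose guards are 11 and 12.
\<close>

definition gadget_edges :: "(nat \<times> nat) set" where
  "gadget_edges =
     {(3, 4), (4, 2),
      (0, 5), (5, 6), (6, 1), (5, 7), (7, 2), (6, 8), (8, 2),
      (0, 9), (9, 10), (10, 1),
      (9, 11), (11, 3), (11, 13), (13, 2),
      (10, 12), (12, 3), (12, 14), (14, 2)}"

definition gadget :: "nat pair_pre_digraph" where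
  "gadget = \<lparr> pverts = {0,1,2,3,4,5,6,7,8,9,10,11,12,13,14},
     parcs = gadget_edges \<union> gadget_edges\<inverse> \<rparr>"

lemma pair_graph_gadget: "pair_graph gadget"
proof
  show "finite (parcs gadget)"
    by (simp add: gadget_def gadget_edges_def)
  show "symmetric (with_proj gadget)"
    by (auto simp: gadget_def symmetric_def arcs_ends_def arc_to_ends_def with_proj_def
        intro!: symI)
qed (auto simp: gadget_def gadget_edges_def)

text \<open>
  A homomorphism from the gadget is the same as a choice of witnesses for the existential
  quantifiers in \<open>linked\<close>. Listing vertices 2 and 3 on both sides makes \<open>c\<close> and \<open>e\<close> parameters
  that adjacent tuples share.
\<close>

lemma arcs_gadget_power:
  assumes sym: "sym (parcs G)"
    and verts: "\<And>u v. (u, v) \<in> parcs G \<Longrightarrow> u \<in> pverts G \<and> v \<in> pverts G"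
  shows "parcs (pp_power 3 gadget [0, 2, 3] [1, 2, 3] G) =
    {([x, c, e], [y, c, e]) | x y c e. linked G c e x y}"
proof (intro equalityI subrelI)
  fix u v
  assume "(u, v) \<in> parcs (pp_power 3 gadget [0, 2, 3] [1, 2, 3] G)"
  then obtain f where f: "graph_hom f gadget G"
    and uv: "u = [f 0, f 2, f 3]" "v = [f 1, f 2, f 3]"
    by (auto simp: pp_power_def)
  have "(f i, f j) \<in> parcs G" if "(i, j) \<in> gadget_edges" for i j
    using f that by (auto simp: graph_hom_def gadget_def)
  then have e: "\<forall>(i, j) \<in> gadget_edges. (f i, f j) \<in> parcs G"
    by blast
  have "linked G (f 2) (f 3) (f 0) (f 1)"
    using e unfolding gadget_edges_def linked_def near_def has_guard_def path_through_def
    by simp blast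
  then show "(u, v) \<in> {([x, c, e], [y, c, e]) | x y c e. linked G c e x y}"
    by (auto simp: uv)
next
  fix u v
  assume "(u, v) \<in> {([x, c, e], [y, c, e]) | x y c e. linked G c e x y}"
  then obtain x y c e where uv: "u = [x, c, e]" "v = [y, c, e]" and l: "linked G c e x y"
    by blast
  from l obtain w p q r s p' q' d d' r' s' where
    arcs: "(e, w) \<in> parcs G" "(w, c) \<in> parcs G"
      "(x, p) \<in> parcs G" "(p, q) \<in> parcs G" "(q, y) \<in> parcs G"
      "(p, r) \<in> parcs G" "(r, c) \<in> parcs G" "(q, s) \<in> parcs G" "(s, c) \<in> parcs G"
      "(x, p') \<in> parcs G" "(p', q') \<in> parcs G" "(q', y) \<in> parcs G"
      "(p', d) \<in> parcs G" "(d, e) \<in> parcs G" "(d, r') \<in> parcs G" "(r', c) \<in> parcs G"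
      "(q', d') \<in> parcs G" "(d', e) \<in> parcs G" "(d', s') \<in> parcs G" "(s', c) \<in> parcs G"
    unfolding linked_def near_def has_guard_def path_through_def by blast
  define f where "f = nth [x, y, c, e, w, p, q, r, s, p', q', d, d', r', s']"
  have "graph_hom f gadget G"
    unfolding graph_hom_def gadget_def gadget_edges_def f_def
    using arcs arcs[THEN symD[OF sym]] arcs[THEN verts] by auto
  moreover have "u = map f [0, 2, 3]" "v = map f [1, 2, 3]"
    by (simp_all add: uv f_def)
  ultimately show "(u, v) \<in> parcs (pp_power 3 gadget [0, 2, 3] [1, 2, 3] G)"
    unfolding pp_power_def by auto
qed

lemma linked_sym:
  assumes sym: "sym (parcs G)"
    and "linked G c e x y"
  shows "linked G c e y x"
proof -
  have "path_through G S y x" if "path_through G S x y" for S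
    using that symD[OF sym] unfolding path_through_def by blast
  with assms(2) show ?thesis
    by (simp add: linked_def)
qed

section \<open>Linked vertices lie in different sectors\<close>

definition sector :: "complex \<Rightarrow> complex \<Rightarrow> nat" where
  "sector c x =
     (if Arg2pi (x / c) < 2 * pi / 3 then 0 else if Arg2pi (x / c) \<le> 4 * pi / 3 then 1 else 2)"

text \<open>
  The path through vertices near \<open>c\<close> excludes that both ends are in sector 0 or both in sector 2,
  and the path through guarded vertices that both are in sector 1. With the angles \<open>a\<close> from \<open>c\<close>,
  all of this is a case distinction over linear inequalities.
\<close>

lemma linked_sector_neq:
  assumes V: "V \<subseteq> sphere 0 1" and l: "linked (C3 V) c e x y"
  shows "sector c x \<noteq> sector c y"
proof
  assume same: "sector c x = sector c y"
  define h where "h = 2 * pi / 3"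
  define a where "a z = Arg2pi (z / c)" for z
  have sector: "sector c z = (if a z < h then 0 else if a z \<le> 2 * h then 1 else 2)" for z
    by (simp add: sector_def a_def h_def)
  have range: "0 \<le> a z" "a z < 3 * h" for z
    using Arg2pi_ge_0[of "z / c"] Arg2pi_lt_2pi[of "z / c"] by (simp_all add: a_def h_def)
  have "c \<in> V"
    using l C3_arc_verts unfolding linked_def near_def by blast
  then have arc: "h < \<bar>a u - a v\<bar> \<and> \<bar>a u - a v\<bar> < 2 * h" if "(u, v) \<in> parcs (C3 V)" for u v
    using that C3_arc_iff_angle[OF V] C3_arc_verts[OF that] by (simp add: a_def h_def)
  have "a c = 0"
    using V \<open>c \<in> V\<close> Arg2pi_of_real[of 1] by (auto simp: a_def subset_iff)
  have near: "a z < h \<or> 2 * h < a z" if "near (C3 V) c z" for z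
  proof -
    obtain r where "(z, r) \<in> parcs (C3 V)" "(r, c) \<in> parcs (C3 V)"
      using \<open>near (C3 V) c z\<close> by (auto simp: near_def)
    from this[THEN arc] show ?thesis
      using range[of r] range[of z] \<open>a c = 0\<close> by linarith
  qed
  have "near (C3 V) c e"
    using l by (simp add: linked_def)
  \<comment> \<open>Which side of \<open>c\<close> the guards are on depends on \<open>e\<close>, but it is the same for all guarded
    vertices.\<close>
  from near[OF this] have guarded: "(\<forall>z. has_guard (C3 V) c e z \<longrightarrow> a z \<le> 2 * h) \<or>
    (\<forall>z. has_guard (C3 V) c e z \<longrightarrow> h \<le> a z)"
  proof
    assume e: "a e < h"
    have "a z \<le> 2 * h" if "has_guard (C3 V) c e z" for z
    proof -
      obtain d where d: "(z, d) \<in> parcs (C3 V)" "(d, e) \<in> parcs (C3 V)" "near (C3 V) c d"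
        using \<open>has_guard (C3 V) c e z\<close> by (auto simp: has_guard_def)
      show ?thesis
        using arc[OF d(1)] arc[OF d(2)] near[OF d(3)] e range[of d] range[of z] range[of e]
        by linarith
    qed
    then show ?thesis by blast
  next
    assume e: "2 * h < a e"
    have "h \<le> a z" if "has_guard (C3 V) c e z" for z
    proof -
      obtain d where d: "(z, d) \<in> parcs (C3 V)" "(d, e) \<in> parcs (C3 V)" "near (C3 V) c d"
        using \<open>has_guard (C3 V) c e z\<close> by (auto simp: has_guard_def)
      show ?thesis
        using arc[OF d(1)] arc[OF d(2)] near[OF d(3)] e range[of d] range[of z] range[of e]
        by linarith
    qed
    then show ?thesis by blast
  qed
  obtain p q where "(x, p) \<in> parcs (C3 V)" "(p, q) \<in> parcs (C3 V)" "(q, y) \<in> parcs (C3 V)"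
    and "near (C3 V) c p" "near (C3 V) c q"
    using l by (auto simp: linked_def path_through_def)
  note outer = this(1-3)[THEN arc] this(4,5)[THEN near]
  obtain p' q' where "(x, p') \<in> parcs (C3 V)" "(p', q') \<in> parcs (C3 V)" "(q', y) \<in> parcs (C3 V)"
    and g: "has_guard (C3 V) c e p'" "has_guard (C3 V) c e q'"
    using l by (auto simp: linked_def path_through_def)
  note middle = this(1-3)[THEN arc]
  consider "a x < h" "a y < h" | "2 * h < a x" "2 * h < a y"
    | "h \<le> a x" "a x \<le> 2 * h" "h \<le> a y" "a y \<le> 2 * h"
    using same by (fastforce simp: sector split: if_splits)
  then show False
  proof cases
    case 1
    then have "2 * h < a p" "2 * h < a q"
      using outer range[of x] range[of y] range[of p] range[of q] by linarith+
    then show False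
      using outer(2) range[of p] range[of q] by linarith
  next
    case 2
    then have "a p < h" "a q < h"
      using outer range[of x] range[of y] range[of p] range[of q] by linarith+
    then show False
      using outer(2) range[of p] range[of q] by linarith
  next
    case 3
    then have ends: "a p' < h \<or> 2 * h < a p'" "a q' < h \<or> 2 * h < a q'"
      using middle range[of p'] range[of q'] by linarith+
    from guarded show False
    proof
      assume "\<forall>z. has_guard (C3 V) c e z \<longrightarrow> a z \<le> 2 * h"
      then have "a p' < h" "a q' < h"
        using ends g by fastforce+
      then show False
        using middle(2) range[of p'] range[of q'] by linarith
    next
      assume "\<forall>z. has_guard (C3 V) c e z \<longrightarrow> h \<le> a z"
      then have "2 * h < a p'" "2 * h < a q'"
        using ends g by fastforce+
      then show False
        using middle(2) range[of p'] range[of q'] by linarith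
    qed
  qed
qed

section \<open>A linked triangle\<close>

text \<open>
  Let \<open>P k\<close> be near the point \<open>k/11\<close> of the circle, so that \<open>P j\<close> and \<open>P k\<close> are adjacent if \<open>j\<close> and
  \<open>k\<close> are at least 4 apart modulo 11. Take \<open>c = P 0\<close>, and \<open>e = P 3\<close>, which is as far from \<open>c\<close> as
  possible within sector 0: the guards are then \<open>P 8\<close>, \<open>P 9\<close> and \<open>P 10\<close>, and their neighbours
  include points of both sectors 0 and 1. The triangle consists of \<open>P 1\<close>, \<open>P 5\<close> and \<open>P 9\<close>, one
  point in each sector.
\<close>

lemma linked_triangle_exists:
  assumes "V \<subseteq> sphere 0 1" "sphere 0 1 \<subseteq> closure V"
  shows "\<exists>c e x. \<forall>i<3. \<forall>j<3. i \<noteq> j \<longrightarrow> linked (C3 V) c e (x i) (x (j::nat))"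
proof -
  obtain P :: "nat \<Rightarrow> complex" where P: "(P j, P k) \<in> parcs (C3 V)"
    if "j < 11" "k < 11" "11 < 3 * \<bar>int j - int k\<bar>" "3 * \<bar>int j - int k\<bar> < 22" for j k
    using circular_clique_in_C3[OF assms, of 11] by auto
  have near: "near (C3 V) (P 0) (P k)" if "k \<in> {1, 2, 3, 8, 9, 10}" for k
    unfolding near_def
    by (rule exI[of _ "P (if k = 1 then 5 else if k = 2 then 6 else if k = 3 then 7
        else 4)"]) (use that in \<open>auto intro!: P\<close>)
  have guard: "has_guard (C3 V) (P 0) (P 3) (P k)" if "k \<in> {1, 2, 4, 5, 6}" for k
    unfolding has_guard_def
    by (rule exI[of _ "P (if k = 5 then 9 else if k = 6 then 10 else 8)"])
      (use that in \<open>auto intro!: P near\<close>)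
  have linked: "linked (C3 V) (P 0) (P 3) (P x) (P y)"
    if "(P x, P p) \<in> parcs (C3 V)" "(P p, P q) \<in> parcs (C3 V)" "(P q, P y) \<in> parcs (C3 V)"
      "p \<in> {1, 2, 3, 8, 9, 10}" "q \<in> {1, 2, 3, 8, 9, 10}"
      "(P x, P p') \<in> parcs (C3 V)" "(P p', P q') \<in> parcs (C3 V)" "(P q', P y) \<in> parcs (C3 V)"
      "p' \<in> {1, 2, 4, 5, 6}" "q' \<in> {1, 2, 4, 5, 6}"
    for x y p q p' q'
    unfolding linked_def path_through_def
    using near[of 3] near guard that by blast
  \<comment> \<open>The first four numbers are the indices along the path near \<open>c\<close>, the last two those of the
    inner vertices of the guarded path.\<close>
  have "linked (C3 V) (P 0) (P 3) (P 1) (P 5)"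
    by (rule linked[of 1 8 1 5 5 1]) (auto intro: P)
  moreover have "linked (C3 V) (P 0) (P 3) (P 1) (P 9)"
    by (rule linked[of 1 8 2 9 6 2]) (auto intro: P)
  moreover have "linked (C3 V) (P 0) (P 3) (P 5) (P 9)"
    by (rule linked[of 5 9 2 9 1 5]) (auto intro: P)
  moreover note calculation[THEN linked_sym[OF sym_C3]]
  ultimately have "\<forall>i<3. \<forall>j<3. i \<noteq> j \<longrightarrow>
      linked (C3 V) (P 0) (P 3) ([P 1, P 5, P 9] ! i) ([P 1, P 5, P 9] ! j)"
    by (simp add: numeral_3_eq_3 less_Suc_eq all_conj_distrib)
  then show ?thesis
    by (intro exI[of _ "P 0"] exI[of _ "P 3"] exI[of _ "\<lambda>i. [P 1, P 5, P 9] ! i"])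
qed

theorem theorem46:
  fixes V :: "complex set" and K3 :: "'a pair_pre_digraph"
  assumes "C3_vertex_set V"
    and "complete_digraph 3 (with_proj K3)"
  shows "has_pp_construction K3 (C3 V)"
proof -
  have V: "V \<subseteq> sphere 0 1" "sphere 0 1 \<subseteq> closure V"
    using assms(1) by (auto simp: C3_vertex_set_def)
  have "finite (pverts K3)" "card (pverts K3) = 3"
    and K3_arcs: "parcs K3 = {(u, v). u \<in> pverts K3 \<and> v \<in> pverts K3 \<and> u \<noteq> v}"
    using assms(2) by (auto simp: complete_digraph_pair_def)
  then obtain b where b: "bij_betw b {..<3::nat} (pverts K3)"
    by (metis atLeast0LessThan ex_bij_betw_nat_finite)
  then obtain b' where b': "bij_betw b' (pverts K3) {..<3::nat}"
    using bij_betw_inv by blast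
  let ?H = "pp_power 3 gadget [0, 2, 3] [1, 2, 3] (C3 V)"
  have H_arcs: "parcs ?H = {([x, c, e], [y, c, e]) | x y c e. linked (C3 V) c e x y}"
    by (rule arcs_gadget_power[OF sym_C3]) (auto simp: C3_def)
  have "\<exists>f. graph_hom f K3 ?H"
  proof -
    obtain c e x where l: "\<forall>i<3. \<forall>j<3. i \<noteq> j \<longrightarrow> linked (C3 V) c e (x i) (x (j::nat))"
      using linked_triangle_exists[OF V] by blast
    have verts: "c \<in> V" "e \<in> V" "x i \<in> V" if "i < 3" for i
    proof -
      obtain j where "j < 3" "i \<noteq> (j::nat)"
        by (metis that zero_less_numeral one_less_numeral_iff semiring_norm(77) zero_neq_one)
      then have "linked (C3 V) c e (x i) (x j)"
        using l that by blast
      then show "c \<in> V" "e \<in> V" "x i \<in> V"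
        unfolding linked_def near_def path_through_def using C3_arc_verts by blast+
    qed
    have index: "b' u < 3" if "u \<in> pverts K3" for u
      using b' that by (auto simp: bij_betw_def)
    have "b' u \<noteq> b' v" if "u \<in> pverts K3" "v \<in> pverts K3" "u \<noteq> v" for u v
      using b' that by (auto simp: bij_betw_def inj_on_def)
    then have "graph_hom (\<lambda>u. [x (b' u), c, e]) K3 ?H"
      unfolding graph_hom_def H_arcs using l index verts(3) verts(1,2)[of 0]
      by (auto simp: K3_arcs pp_power_def C3_def)
    then show ?thesis by blast
  qed
  moreover have "\<exists>g. graph_hom g ?H K3"
  proof -
    have "b (sector c x) \<in> pverts K3" for c x
      using b by (auto simp: sector_def bij_betw_def)
    moreover have "b (sector c x) \<noteq> b (sector c y)" if "linked (C3 V) c e x y" for c e x y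
    proof -
      have "sector c z \<in> {..<3}" for z
        by (simp add: sector_def)
      then show ?thesis
        using linked_sector_neq[OF V(1) that] b by (metis bij_betw_def inj_on_eq_iff)
    qed
    ultimately have "graph_hom (\<lambda>u. b (sector (u ! 1) (u ! 0))) ?H K3"
      unfolding graph_hom_def H_arcs K3_arcs by (auto simp: nth_Cons')
    then show ?thesis by blast
  qed
  moreover have "sym (parcs ?H)"
    unfolding H_arcs using linked_sym[OF sym_C3] by (blast intro: symI)
  then have "symmetric (with_proj ?H)"
    by (simp add: symmetric_def)
  ultimately show ?thesis
    unfolding has_pp_construction_def hom_equivalent_def
    by (intro exI[of _ 3] exI[of _ gadget] exI[of _ "[0, 2, 3]"] exI[of _ "[1, 2, 3]"])
      (auto simp: pair_graph_gadget, auto simp: gadget_def)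
qed

end
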